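(* $\mathrm{Der}(\mathcal{A},-)=\{d_{\lambda,\beta}\mid \lambda,\beta\in\mathbb{F}\}$, where for $\lambda,\beta\in\mathbb{F}$ the linear map $d_{\lambda,\beta}\colon\mathcal{A}\to\mathcal{A}$ is defined by $$d_{\lambda,\beta}(r_01+r_1x_1+r_2x_2+r_3x_3)=\lambda\, r_1(sx_1)+\beta\, r_2(sx_2)-(\lambda+\beta)\,r_3(sx_3)\qquad (r_0,r_1,r_2,r_3\in\mathcal{K}).$$
   Context: $\mathbb{F}$ is an algebraically closed field of characteristic different from $2,3,5$. Let $\mathcal{B}=\mathbb{F}\oplus\mathbb{F}\oplus\mathbb{F}\oplus\mathbb{F}$ with componentwise product, $t$ its trace (sum of the four coordinates), and $b^\theta=-b+\tfrac12 t(b)1$ for $b\in\mathcal{B}$. The split quartic Cayley algebra is the (nonassociative, unital) algebra with involution $\mathcal{A}=\mathcal{B}\oplus s\mathcal{B}=\{b_1+sb_2\mid b_1,b_2\in\mathcal{B}\}$, with product and involution $$(b_1+sb_2)(b_3+sb_4)=\big(b_1b_3+(b_2b_4^\theta)^\theta\big)+s\big(b_1^\theta b_4+(b_2^\theta b_3^\theta)^\theta\big),\qquad \overline{b_1+sb_2}=b_1-sb_2^\theta .$$ Write $s=s1$, $x_1=(1,1,-1,-1)$, $x_2=(1,-1,1,-1)$, $x_3=(1,-1,-1,1)\in\mathcal{B}$, and $\mathcal{K}=\mathbb{F}1\oplus\mathbb{F}s$, a subalgebra with $s^2=1$. For $r\in\mathcal{K}$, $rx$ denotes the product in $\mathcal{A}$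 of $r$ and $x$ (in this order); every element of $\mathcal{A}$ is uniquely of the form $r_01+r_1x_1+r_2x_2+r_3x_3$ with $r_i\in\mathcal{K}$. $\mathrm{Der}(\mathcal{A},-)$ is the space of $\mathbb{F}$-linear derivations of $\mathcal{A}$ commuting with the involution. *)

theory Defs
  imports "HOL-Analysis.Analysis" "HOL-Computational_Algebra.Polynomial"
begin

section \<open>The split quartic Cayley algebra\<close>

text \<open>
  The algebra \<open>\<B>\<close> is \<open>'a^4\<close>: the library's product \<open>*\<close>, unit \<open>1\<close> and scalar multiplication \<open>*s\<close>
  on this type are the componentwise ones.
\<close>

definition tr :: "'a::field^4 \<Rightarrow> 'a" where
  "tr b = (\<Sum>i\<in>UNIV. b $ i)"

definition theta :: "'a::field^4 \<Rightarrow> 'a^4" where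
  "theta b = - b + (1 / 2 * tr b) *s 1"

text \<open>The pair \<open>(b\<^sub>1, b\<^sub>2)\<close> stands for \<open>b\<^sub>1 + s b\<^sub>2\<close>; addition is the componentwise one on pairs.\<close>

type_synonym 'a qcayley = "('a^4) \<times> ('a^4)"

fun qscale :: "'a::field \<Rightarrow> 'a qcayley \<Rightarrow> 'a qcayley"  (infixr \<open>*\<^sub>q\<close> 75) where
  "c *\<^sub>q (b1, b2) = (c *s b1, c *s b2)"

fun qmult :: "'a::field qcayley \<Rightarrow> 'a qcayley \<Rightarrow> 'a qcayley"  (infixl \<open>\<odot>\<close> 70) where
  "(b1, b2) \<odot> (b3, b4) =
     (b1 * b3 + theta (b2 * theta b4), theta b1 * b4 + theta (theta b2 * theta b3))"

fun qconj :: "'a::field qcayley \<Rightarrow> 'a qcayley" where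
  "qconj (b1, b2) = (b1, - theta b2)"

definition qone :: "'a::field qcayley" where "qone = (1, 0)"
definition qs :: "'a::field qcayley" where "qs = (0, 1)"
definition x1 :: "'a::field qcayley" where "x1 = (vector [1, 1, -1, -1], 0)"
definition x2 :: "'a::field qcayley" where "x2 = (vector [1, -1, 1, -1], 0)"
definition x3 :: "'a::field qcayley" where "x3 = (vector [1, -1, -1, 1], 0)"

definition qK :: "'a::field qcayley set" where
  "qK = {a *\<^sub>q qone + c *\<^sub>q qs | a c. True}"

definition qDer :: "('a::field qcayley \<Rightarrow> 'a qcayley) set" where
  "qDer = {d. Vector_Spaces.linear (*\<^sub>q) (*\<^sub>q) d
            \<and> (\<forall>x y. d (x \<odot> y) = d x \<odot> y + x \<odot> d y)
            \<and> (\<forall>x. d (qconj x) = qconj (d x))}"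

text \<open>
  The map is specified on \<open>r\<^sub>0 1 + r\<^sub>1 x\<^sub>1 + r\<^sub>2 x\<^sub>2 + r\<^sub>3 x\<^sub>3\<close>. Over a field with \<open>2 \<noteq> 0\<close> every
  element has exactly one such presentation, so the description below is proper;
  see \<open>qd_apply\<close>.
\<close>

definition qd :: "'a::field \<Rightarrow> 'a \<Rightarrow> 'a qcayley \<Rightarrow> 'a qcayley" where
  "qd l b = (THE d. \<forall>r0\<in>qK. \<forall>r1\<in>qK. \<forall>r2\<in>qK. \<forall>r3\<in>qK.
     d (r0 \<odot> qone + r1 \<odot> x1 + r2 \<odot> x2 + r3 \<odot> x3) =
       l *\<^sub>q (r1 \<odot> (qs \<odot> x1)) + b *\<^sub>q (r2 \<odot> (qs \<odot> x2)) - (l + b) *\<^sub>q (r3 \<odot> (qs \<odot> x3)))"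


section \<open>Basic facts\<close>

lemma vector_4 [simp]:
  "(vector [a, b, c, d] :: 'a::zero^4) $ 1 = a"
  "(vector [a, b, c, d] :: 'a::zero^4) $ 2 = b"
  "(vector [a, b, c, d] :: 'a::zero^4) $ 3 = c"
  "(vector [a, b, c, d] :: 'a::zero^4) $ 4 = d"
  by (simp_all add: vector_def)

lemma vector_space_qscale: "vector_space ((*\<^sub>q) :: 'a::field \<Rightarrow> _)"
  by unfold_locales (auto simp: vec_eq_iff algebra_simps)

lemma theta_scaled_one [simp]:
  assumes "(2::'a::field) \<noteq> 0"
  shows "theta (a *s 1) = (a *s 1 :: 'a^4)"
proof -
  have "1 / 2 * tr (a *s 1 :: 'a^4) = 2 * a"
    using assms by (simp add: tr_def sum_4 field_simps)
  then show ?thesis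
    by (simp add: theta_def vec_eq_iff algebra_simps)
qed

lemma theta_one [simp]: "(2::'a::field) \<noteq> 0 \<Longrightarrow> theta 1 = (1 :: 'a^4)"
  using theta_scaled_one[of 1] by simp

lemma theta_zero [simp]: "theta 0 = 0"
  by (simp add: theta_def tr_def vec_eq_iff)

lemma theta_scale: "theta (a *s b) = a *s theta b"
  by (simp add: theta_def tr_def vec_eq_iff sum_distrib_left algebra_simps)

lemma theta_theta [simp]:
  assumes "(2::'a::field) \<noteq> 0"
  shows "theta (theta b) = (b :: 'a^4)"
proof -
  define h where "h = 1 / 2 * tr b"
  have "tr (theta b) = - tr b + 2 * (2 * h)"
    unfolding theta_def h_def[symmetric] by (simp add: tr_def sum_4)
  also have "2 * h = tr b"
    using assms by (simp add: h_def)
  also have "- tr b + 2 * tr b = tr b"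
    by simp
  finally have "tr (theta b) = tr b" .
  then show ?thesis
    by (simp add: theta_def[of "theta b"]) (simp add: theta_def)
qed

lemma scale_one_mult: "(c *s 1) * b = c *s (b :: 'a::field^4)"
  by (simp add: vec_eq_iff)

lemma qone_mult: "(2::'a::field) \<noteq> 0 \<Longrightarrow> qone \<odot> x = (x :: 'a qcayley)"
  by (cases x) (simp add: qone_def)

lemma mult_qone: "(2::'a::field) \<noteq> 0 \<Longrightarrow> x \<odot> qone = (x :: 'a qcayley)"
  by (cases x) (simp add: qone_def)

lemma qs_square: "(2::'a::field) \<noteq> 0 \<Longrightarrow> qs \<odot> qs = (qone :: 'a qcayley)"
  by (simp add: qs_def qone_def)

lemma qs_mult: "(2::'a::field) \<noteq> 0 \<Longrightarrow> qs \<odot> (b, 0) = ((0, b) :: 'a qcayley)"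
  by (simp add: qs_def)

lemma qK_mult:
  assumes "(2::'a::field) \<noteq> 0"
  shows "(a *\<^sub>q qone + c *\<^sub>q qs) \<odot> (b, 0) = ((a *s b, c *s b) :: 'a qcayley)"
    and "(a *\<^sub>q qone + c *\<^sub>q qs) \<odot> (0, b) = ((c *s b, a *s b) :: 'a qcayley)"
  using assms by (simp_all add: qone_def qs_def scale_one_mult theta_scale)

definition qpres :: "'a::field qcayley \<Rightarrow> 'a qcayley \<Rightarrow> 'a qcayley \<Rightarrow> 'a qcayley \<Rightarrow> 'a qcayley" where
  "qpres r0 r1 r2 r3 = r0 \<odot> qone + r1 \<odot> x1 + r2 \<odot> x2 + r3 \<odot> x3"

definition sgn_coeff :: "'a::field^4 \<Rightarrow> 'a^4 \<Rightarrow> 'a" where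
  "sgn_coeff v b = (\<Sum>i\<in>UNIV. v $ i * b $ i) / 4"

definition qcoeff :: "'a::field^4 \<Rightarrow> 'a qcayley \<Rightarrow> 'a qcayley" where
  "qcoeff v x = sgn_coeff v (fst x) *\<^sub>q qone + sgn_coeff v (snd x) *\<^sub>q qs"

lemma qcoeff_in_qK: "qcoeff v x \<in> qK"
  by (auto simp: qcoeff_def qK_def)

lemma sgn_coeff_expand:
  assumes "(2::'a::field) \<noteq> 0"
  shows "b = sgn_coeff 1 b *s 1
     + sgn_coeff (vector [1, 1, -1, -1]) b *s vector [1, 1, -1, -1]
     + sgn_coeff (vector [1, -1, 1, -1]) b *s vector [1, -1, 1, -1]
     + sgn_coeff (vector [1, -1, -1, 1]) b *s (vector [1, -1, -1, 1] :: 'a^4)"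
proof -
  have "(4::'a) = 2 * 2" by simp
  then have 4: "(4::'a) \<noteq> 0" using assms by (metis mult_eq_0_iff)
  define k :: 'a where "k = 1 / 4"
  have *: "u / 4 = k * u" for u by (simp add: k_def)
  have k: "k * 4 = 1" using 4 by (simp add: k_def)
  have k1: "k * (x+y+z+w) + k * (x+y-z-w) + k * (x-y+z-w) + k * (x-y-z+w) = x"
    and k2: "k * (x+y+z+w) + k * (x+y-z-w) - k * (x-y+z-w) - k * (x-y-z+w) = y"
    and k3: "k * (x+y+z+w) - k * (x+y-z-w) + k * (x-y+z-w) - k * (x-y-z+w) = z"
    and k4: "k * (x+y+z+w) - k * (x+y-z-w) - k * (x-y+z-w) + k * (x-y-z+w) = w" for x y z w
    using k by algebra+
  show ?thesis
    unfolding sgn_coeff_def * vec_eq_iff forall_4 sum_4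
    using k1 k2 k3 k4 by simp
qed

lemma sgn_coeff_unique:
  fixes p q r t :: "'a::field"
  assumes "(2::'a) \<noteq> 0"
  defines "b \<equiv> p *s 1 + q *s vector [1, 1, -1, -1] + r *s vector [1, -1, 1, -1]
                + t *s (vector [1, -1, -1, 1] :: 'a^4)"
  shows "sgn_coeff 1 b = p" "sgn_coeff (vector [1, 1, -1, -1]) b = q"
    "sgn_coeff (vector [1, -1, 1, -1]) b = r" "sgn_coeff (vector [1, -1, -1, 1]) b = t"
proof -
  have "(4::'a) = 2 * 2" by simp
  then have 4: "(4::'a) \<noteq> 0" using assms(1) by (metis mult_eq_0_iff)
  show "sgn_coeff 1 b = p" "sgn_coeff (vector [1, 1, -1, -1]) b = q"
    "sgn_coeff (vector [1, -1, 1, -1]) b = r" "sgn_coeff (vector [1, -1, -1, 1]) b = t"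
    using 4 by (simp_all add: b_def sgn_coeff_def sum_4 field_simps)
qed

lemma qpres_eq:
  assumes "(2::'a::field) \<noteq> 0"
  shows "qpres (p0 *\<^sub>q qone + q0 *\<^sub>q qs) (p1 *\<^sub>q qone + q1 *\<^sub>q qs)
           (p2 *\<^sub>q qone + q2 *\<^sub>q qs) (p3 *\<^sub>q qone + q3 *\<^sub>q qs) =
    ((p0 *s 1 + p1 *s vector [1, 1, -1, -1] + p2 *s vector [1, -1, 1, -1] + p3 *s vector [1, -1, -1, 1],
      q0 *s 1 + q1 *s vector [1, 1, -1, -1] + q2 *s vector [1, -1, 1, -1] + q3 *s vector [1, -1, -1, 1])
      :: 'a qcayley)"
proof -
  have one: "(p *\<^sub>q qone + q *\<^sub>q qs) \<odot> qone = ((p *s 1, q *s 1) :: 'a qcayley)" for p q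
    using qK_mult(1)[OF assms, of p q 1] by (simp only: qone_def)
  show ?thesis
    unfolding qpres_def one x1_def x2_def x3_def qK_mult[OF assms] by simp
qed

lemma qpres_exists:
  assumes "(2::'a::field) \<noteq> 0"
  shows "qpres (qcoeff 1 x) (qcoeff (vector [1, 1, -1, -1]) x)
           (qcoeff (vector [1, -1, 1, -1]) x) (qcoeff (vector [1, -1, -1, 1]) x)
         = (x :: 'a qcayley)"
  unfolding qcoeff_def qpres_eq[OF assms]
  by (cases x) (simp flip: sgn_coeff_expand[OF assms])

lemma qpres_unique:
  assumes "(2::'a::field) \<noteq> 0"
    and "r0 \<in> qK" "r1 \<in> qK" "r2 \<in> qK" "r3 \<in> (qK :: 'a qcayley set)"
  shows "qcoeff 1 (qpres r0 r1 r2 r3) = r0"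
    "qcoeff (vector [1, 1, -1, -1]) (qpres r0 r1 r2 r3) = r1"
    "qcoeff (vector [1, -1, 1, -1]) (qpres r0 r1 r2 r3) = r2"
    "qcoeff (vector [1, -1, -1, 1]) (qpres r0 r1 r2 r3) = r3"
proof -
  obtain p0 q0 p1 q1 p2 q2 p3 q3 where
    r: "r0 = p0 *\<^sub>q qone + q0 *\<^sub>q qs" "r1 = p1 *\<^sub>q qone + q1 *\<^sub>q qs"
       "r2 = p2 *\<^sub>q qone + q2 *\<^sub>q qs" "r3 = p3 *\<^sub>q qone + q3 *\<^sub>q qs"
    using assms(2-5) by (auto simp: qK_def)
  show "qcoeff 1 (qpres r0 r1 r2 r3) = r0"
    "qcoeff (vector [1, 1, -1, -1]) (qpres r0 r1 r2 r3) = r1"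
    "qcoeff (vector [1, -1, 1, -1]) (qpres r0 r1 r2 r3) = r2"
    "qcoeff (vector [1, -1, -1, 1]) (qpres r0 r1 r2 r3) = r3"
    unfolding r qpres_eq[OF assms(1)] qcoeff_def fst_conv snd_conv sgn_coeff_unique[OF assms(1)]
    by (rule refl)+
qed

theorem qd_apply:
  assumes "(2::'a::field) \<noteq> 0"
    and "r0 \<in> qK" "r1 \<in> qK" "r2 \<in> qK" "r3 \<in> (qK :: 'a qcayley set)"
  shows "qd l b (r0 \<odot> qone + r1 \<odot> x1 + r2 \<odot> x2 + r3 \<odot> x3) =
    l *\<^sub>q (r1 \<odot> (qs \<odot> x1)) + b *\<^sub>q (r2 \<odot> (qs \<odot> x2)) - (l + b) *\<^sub>q (r3 \<odot> (qs \<odot> x3))"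
proof -
  define f :: "'a qcayley \<Rightarrow> 'a qcayley \<Rightarrow> 'a qcayley \<Rightarrow> 'a qcayley" where
    "f r1 r2 r3 = l *\<^sub>q (r1 \<odot> (qs \<odot> x1)) + b *\<^sub>q (r2 \<odot> (qs \<odot> x2))
                 - (l + b) *\<^sub>q (r3 \<odot> (qs \<odot> x3))" for r1 r2 r3
  define P where "P d \<longleftrightarrow> (\<forall>r0\<in>qK. \<forall>r1\<in>qK. \<forall>r2\<in>qK. \<forall>r3\<in>qK.
    d (qpres r0 r1 r2 r3) = f r1 r2 r3)" for d :: "'a qcayley \<Rightarrow> 'a qcayley"
  define g where "g x = f (qcoeff (vector [1, 1, -1, -1]) x)
    (qcoeff (vector [1, -1, 1, -1]) x) (qcoeff (vector [1, -1, -1, 1]) x)" for x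
  have "P g"
    by (simp add: P_def g_def qpres_unique[OF assms(1)])
  moreover have "d = g" if "P d" for d
  proof
    fix x
    have "d (qpres (qcoeff 1 x) (qcoeff (vector [1, 1, -1, -1]) x)
           (qcoeff (vector [1, -1, 1, -1]) x) (qcoeff (vector [1, -1, -1, 1]) x)) = g x"
      using that qcoeff_in_qK unfolding P_def g_def by blast
    then show "d x = g x"
      by (simp only: qpres_exists[OF assms(1)])
  qed
  ultimately have "P (THE d. P d)"
    by (rule theI)
  moreover have "(THE d. P d) = qd l b"
    unfolding P_def qd_def qpres_def f_def ..
  ultimately show ?thesis
    using assms(2-5) unfolding P_def qpres_def f_def by simp
qed

end

theory Submission
  imports Defs
begin

text \<open>
  Write \<open>V\<^sub>i\<close> for the coordinate vector of \<open>x\<^sub>i\<close>, so that \<open>x\<^sub>i = (V\<^sub>i, 0)\<close> and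
  \<open>s x\<^sub>i = (0, V\<^sub>i)\<close>. The vectors \<open>1, V\<^sub>1, V\<^sub>2, V\<^sub>3\<close> form a Klein four-group that is a basis of
  \<open>\<B>\<close>, and \<open>\<theta>\<close> fixes \<open>1\<close> and negates each \<open>V\<^sub>i\<close>.

  A derivation \<open>d\<close> that commutes with the involution kills \<open>1\<close>. It also kills \<open>s\<close>: the skew
  elements are the multiples of \<open>s\<close>, so \<open>d s = c s\<close>, and differentiating \<open>s\<^sup>2 = 1\<close> gives
  \<open>2 c = 0\<close>. Hence \<open>d\<close> commutes with left multiplication by \<open>\<K>\<close> and is determined by the three
  values \<open>d x\<^sub>i\<close>. Since \<open>x\<^sub>i\<close> is hermitian with \<open>x\<^sub>i\<^sup>2 = 1\<close>, its image is hermitian and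
  anticommutes with \<open>x\<^sub>i\<close>, which forces it to be a multiple \<open>q\<^sub>i (s x\<^sub>i)\<close>
  (\<open>hermitian_anticommuting\<close>). Finally \<open>x\<^sub>1 x\<^sub>2 = x\<^sub>3\<close> yields \<open>q\<^sub>1 + q\<^sub>2 + q\<^sub>3 = 0\<close>.

  Conversely, \<open>d\<^bsub>\<lambda>,\<beta>\<^esub>\<close> is \<open>(u, w) \<mapsto> (D w, D u)\<close>, where \<open>D\<close> is diagonal in the basis
  \<open>1, V\<^sub>1, V\<^sub>2, V\<^sub>3\<close> with eigenvalues \<open>0, \<lambda>, \<beta>, -(\<lambda> + \<beta>)\<close>. Because these eigenvalues sum to
  zero, \<open>D\<close> satisfies the twisted Leibniz rule \<open>D (a b) = a\<^sup>\<theta> D b - (b\<^sup>\<theta> D a)\<^sup>\<theta>\<close>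
  (\<open>diag_mult\<close>), and the derivation law for \<open>d\<^bsub>\<lambda>,\<beta>\<^esub>\<close> consists of four instances of it.
\<close>

section \<open>The involution and the product\<close>

abbreviation V1 :: "'a::field^4" where "V1 \<equiv> vector [1, 1, -1, -1]"
abbreviation V2 :: "'a::field^4" where "V2 \<equiv> vector [1, -1, 1, -1]"
abbreviation V3 :: "'a::field^4" where "V3 \<equiv> vector [1, -1, -1, 1]"

lemma theta_add: "theta (a + b) = theta a + theta b"
  by (simp add: theta_def tr_def vec_eq_iff sum.distrib ring_distribs)

lemma theta_minus: "theta (- a) = - theta a"
  by (simp add: theta_def tr_def vec_eq_iff sum_negf)

lemma theta_V: "theta V1 = - V1" "theta V2 = - V2" "theta V3 = - V3"
  by (simp_all add: theta_def tr_def sum_4)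

lemma V_square: "V1 * V1 = 1" "V2 * V2 = 1" "V3 * V3 = (1 :: 'a::field^4)"
  by (simp_all add: vec_eq_iff forall_4)

lemma scale_mult: "(c *s a) * b = c *s (a * b)" "a * (c *s b) = c *s (a * (b :: 'a::field^4))"
  by (simp_all add: vec_eq_iff)

lemma qmult_zero: "x \<odot> 0 = 0" "0 \<odot> x = (0 :: 'a::field qcayley)"
  by (cases x; simp add: zero_prod_def)+

lemma qmult_scale_right: "x \<odot> (c *\<^sub>q y) = c *\<^sub>q (x \<odot> (y :: 'a::field qcayley))"
  by (cases x; cases y)
    (simp add: theta_scale scale_mult vec.scale_right_distrib)

text \<open>
  Comparing \<open>-a + \<onehalf> t(a) 1\<close> with \<open>a\<close> gives \<open>2 a = \<onehalf> t(a) 1\<close>.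
\<close>
lemma theta_fixed_scalar:
  assumes "(2::'a::field) \<noteq> 0" "theta a = (a :: 'a^4)"
  shows "\<exists>c. a = c *s 1"
proof
  have h: "1 / 2 * tr a = 2 * a $ i" for i
    using arg_cong[OF assms(2), of "\<lambda>v. v $ i"] by (simp add: theta_def algebra_simps)
  have "2 * a $ i = 2 * a $ 1" for i
    using h[of i] h[of 1] by (rule trans[OF sym])
  then show "a = a $ 1 *s 1"
    using assms(1) by (simp add: vec_eq_iff)
qed

section \<open>Derivations are determined by two scalars\<close>

text \<open>
  With \<open>z = (u, w)\<close> and \<open>x = (v, 0)\<close>, the first coordinate of \<open>z x + x z\<close> is \<open>2 u v\<close>, so
  \<open>u = 0\<close> because \<open>v\<close> is its own inverse. As \<open>z\<close> is hermitian, \<open>w\<^sup>\<theta> = -w\<close>, and the second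
  coordinate then says that \<open>w v\<close> is fixed by \<open>\<theta>\<close>; hence \<open>w v\<close> is a scalar and \<open>w\<close> is a
  multiple of \<open>v\<close>.
\<close>
lemma hermitian_anticommuting:
  assumes two: "(2::'a::field) \<noteq> 0" and v: "theta v = - v" "v * v = (1 :: 'a^4)"
    and herm: "qconj z = z" and anti: "z \<odot> (v, 0) + (v, 0) \<odot> z = 0"
  shows "\<exists>q. z = q *\<^sub>q (0, v)"
proof -
  obtain u w where z: "z = (u, w)" by (cases z)
  have tw: "theta w = - w"
    using herm by (simp add: z) (metis minus_minus)
  have 1: "u * v + v * u = 0" and 2: "theta (w * v) + - (v * w) = 0"
    using anti by (simp_all add: z v tw zero_prod_def)
  have "2 * (u * v) $ i = 0" for i
    using arg_cong[OF 1, of "\<lambda>a. a $ i"] by (simp add: algebra_simps)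
  then have "u * v = 0"
    using two by (auto simp: vec_eq_iff)
  then have "u * (v * v) = 0"
    by (simp flip: mult.assoc)
  then have u: "u = 0"
    by (simp add: v(2))
  have "theta (w * v) = w * v"
    using 2 by (simp add: mult.commute)
  then obtain c where "w * v = c *s 1"
    using theta_fixed_scalar[OF two] by blast
  then have "w * (v * v) = c *s v"
    by (simp add: scale_one_mult flip: mult.assoc)
  then have "w = c *s v"
    by (simp add: v(2))
  then show ?thesis
    using u z by auto
qed

text \<open>
  The defining description of \<open>d\<^bsub>\<lambda>,\<beta>\<^esub>\<close> leaves no freedom, because every element of \<open>\<A>\<close> has a
  presentation with coefficients in \<open>\<K>\<close>.
\<close>
lemma eq_qdI:
  assumes two: "(2::'a::field) \<noteq> 0"
    and d: "\<And>r0 r1 r2 r3. r0 \<in> qK \<Longrightarrow> r1 \<in> qK \<Longrightarrow> r2 \<in> qK \<Longrightarrow> r3 \<in> qK \<Longrightarrow>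
      d (r0 \<odot> qone + r1 \<odot> x1 + r2 \<odot> x2 + r3 \<odot> x3) =
      l *\<^sub>q (r1 \<odot> (qs \<odot> x1)) + b *\<^sub>q (r2 \<odot> (qs \<odot> x2)) - (l + b) *\<^sub>q (r3 \<odot> (qs \<odot> x3))"
  shows "d = (qd l b :: 'a qcayley \<Rightarrow> _)"
proof
  fix x :: "'a qcayley"
  show "d x = qd l b x"
    using d[OF qcoeff_in_qK qcoeff_in_qK qcoeff_in_qK qcoeff_in_qK, of 1 x V1 x V2 x V3 x]
      qd_apply[OF two qcoeff_in_qK qcoeff_in_qK qcoeff_in_qK qcoeff_in_qK, of l b 1 x V1 x V2 x V3 x]
    by (simp only: qpres_def[symmetric] qpres_exists[OF two])
qed

lemma qDer_is_qd:
  assumes two: "(2::'a::field) \<noteq> 0" and "d \<in> qDer"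
  shows "\<exists>l b. d = (qd l b :: 'a qcayley \<Rightarrow> _)"
proof -
  have lin: "Vector_Spaces.linear (*\<^sub>q) (*\<^sub>q) d"
    and der: "\<And>x y. d (x \<odot> y) = d x \<odot> y + x \<odot> d y"
    and conj: "\<And>x. d (qconj x) = qconj (d x)"
    using assms(2) by (auto simp: qDer_def)
  have add: "d (x + y) = d x + d y" and scale: "d (c *\<^sub>q x) = c *\<^sub>q d x" for x y c
    using module_hom.add module_hom.scale lin unfolding linear_iff_module_hom by blast+
  have d1: "d qone = 0"
    using der[of qone qone] by (simp add: mult_qone[OF two] qone_mult[OF two])
  have ds: "d qs = 0"
  proof -
    obtain u w where uw: "d qs = (u, w)" by (cases "d qs")
    have "qconj qs = (- 1) *\<^sub>q (qs :: 'a qcayley)"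
      by (simp add: qs_def theta_one[OF two])
    then have "(- 1) *\<^sub>q d qs = qconj (d qs)"
      using conj[of qs] scale by metis
    then have "- u = u" and tw: "theta w = w"
      by (simp_all add: uw vec_eq_iff)
    have "2 * u $ i = 0" for i
      using arg_cong[OF \<open>- u = u\<close>, of "\<lambda>a. a $ i"] by (simp add: minus_equation_iff algebra_simps flip: mult_2)
    then have u: "u = 0"
      using two by (simp add: vec_eq_iff)
    have "d qs \<odot> qs + qs \<odot> d qs = 0"
      using der[of qs qs] by (simp add: qs_square[OF two] d1)
    then have "w + w = 0"
      unfolding uw u by (simp add: qs_def two tw zero_prod_def)
    then have "2 * w $ i = 0" for i
      by (metis mult_2 vector_add_component zero_index)
    then have "w = 0"
      using two by (simp add: vec_eq_iff)
    with u uw show ?thesis by (simp add: zero_prod_def)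
  qed
  have dK: "d r = 0" if "r \<in> qK" for r
    using that by (auto simp: qK_def add scale d1 ds zero_prod_def)
  have dx: "\<exists>q. d (v, 0) = q *\<^sub>q (0, v)" if "theta v = - v" "v * v = 1" for v
  proof (rule hermitian_anticommuting[OF two that])
    show "qconj (d (v, 0)) = d (v, 0)"
      using conj[of "(v, 0)"] by simp
    have "(v, 0) \<odot> (v, 0) = (qone :: 'a qcayley)"
      using that(2) by (simp add: qone_def)
    then show "d (v, 0) \<odot> (v, 0) + (v, 0) \<odot> d (v, 0) = 0"
      using der[of "(v, 0)" "(v, 0)"] d1 by simp
  qed
  obtain q1 q2 q3 where
    q: "d (V1, 0) = q1 *\<^sub>q (0, V1)" "d (V2, 0) = q2 *\<^sub>q (0, V2)" "d (V3, 0) = q3 *\<^sub>q (0, V3)"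
    using dx[OF theta_V(1) V_square(1)] dx[OF theta_V(2) V_square(2)]
      dx[OF theta_V(3) V_square(3)] by metis
  have V12: "V1 * V2 = (V3 :: 'a^4)"
    by (simp add: vec_eq_iff forall_4)
  have "d ((V1, 0) \<odot> (V2, 0)) = (0, - q1 *s V3 - q2 *s V3)"
    unfolding der q
    by (simp add: theta_V theta_scale scale_mult V12 theta_minus)
  moreover have "(V1, 0) \<odot> (V2, 0) = ((V3, 0) :: 'a qcayley)"
    by (simp add: V12)
  ultimately have "q3 *s V3 = - q1 *s V3 - q2 *s (V3 :: 'a^4)"
    using q(3) by simp
  from arg_cong[OF this, of "\<lambda>a. a $ 1"] have q3: "q3 = - (q1 + q2)"
    by simp
  have "d = qd q1 q2"
  proof (rule eq_qdI[OF two])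
    fix r0 r1 r2 r3 :: "'a qcayley"
    assume r: "r0 \<in> qK" "r1 \<in> qK" "r2 \<in> qK" "r3 \<in> qK"
    have neg: "(- c) *\<^sub>q x = - (c *\<^sub>q x)" for c and x :: "'a qcayley"
      by (cases x) (simp add: vec_eq_iff)
    show "d (r0 \<odot> qone + r1 \<odot> x1 + r2 \<odot> x2 + r3 \<odot> x3) =
        q1 *\<^sub>q (r1 \<odot> (qs \<odot> x1)) + q2 *\<^sub>q (r2 \<odot> (qs \<odot> x2)) - (q1 + q2) *\<^sub>q (r3 \<odot> (qs \<odot> x3))"
      unfolding add der dK[OF r(1)] dK[OF r(2)] dK[OF r(3)] dK[OF r(4)] d1
        x1_def x2_def x3_def q qs_mult[OF two] qmult_scale_right qmult_zero
      unfolding q3 neg by simp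
  qed
  then show ?thesis by blast
qed

section \<open>The maps of the family are derivations\<close>

definition bvec :: "'a::field \<Rightarrow> 'a \<Rightarrow> 'a \<Rightarrow> 'a \<Rightarrow> 'a^4" where
  "bvec p0 p1 p2 p3 = p0 *s 1 + p1 *s V1 + p2 *s V2 + p3 *s V3"

definition diag :: "'a::field \<Rightarrow> 'a \<Rightarrow> 'a^4 \<Rightarrow> 'a^4" where
  "diag l b a = bvec 0 (l * sgn_coeff V1 a) (b * sgn_coeff V2 a) (- (l + b) * sgn_coeff V3 a)"

lemma bvec_cases:
  assumes "(2::'a::field) \<noteq> 0"
  obtains p0 p1 p2 p3 where "a = (bvec p0 p1 p2 p3 :: 'a^4)"
  using sgn_coeff_expand[OF assms, of a] unfolding bvec_def by blast

lemma bvec_add: "bvec p0 p1 p2 p3 + bvec r0 r1 r2 r3 = bvec (p0 + r0) (p1 + r1) (p2 + r2) (p3 + r3)"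
  and bvec_minus: "- bvec p0 p1 p2 p3 = bvec (- p0) (- p1) (- p2) (- p3)"
  by (simp_all add: bvec_def vec_eq_iff algebra_simps)

lemma bvec_mult:
  "bvec p0 p1 p2 p3 * bvec r0 r1 r2 r3 =
    bvec (p0 * r0 + p1 * r1 + p2 * r2 + p3 * r3) (p0 * r1 + p1 * r0 + p2 * r3 + p3 * r2)
      (p0 * r2 + p2 * r0 + p1 * r3 + p3 * r1) (p0 * r3 + p3 * r0 + p1 * r2 + p2 * r1)"
  by (simp add: bvec_def vec_eq_iff forall_4 algebra_simps)

lemma theta_bvec:
  assumes "(2::'a::field) \<noteq> 0"
  shows "theta (bvec p0 p1 p2 p3 :: 'a^4) = bvec p0 (- p1) (- p2) (- p3)"
  by (simp add: bvec_def theta_add theta_scale theta_V theta_one[OF assms])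

lemma diag_bvec:
  assumes "(2::'a::field) \<noteq> 0"
  shows "diag l b (bvec p0 p1 p2 p3 :: 'a^4) = bvec 0 (l * p1) (b * p2) (- (l + b) * p3)"
  unfolding diag_def by (simp only: bvec_def sgn_coeff_unique[OF assms])

lemma diag_add: "diag l b (x + y) = diag l b x + diag l b y"
  by (simp add: diag_def bvec_def sgn_coeff_def sum.distrib add_divide_distrib vec_eq_iff
      algebra_simps)

lemma diag_scale: "diag l b (c *s x) = c *s diag l b x"
proof -
  have "sgn_coeff v (c *s x) = c * sgn_coeff v x" for v
    by (simp add: sgn_coeff_def sum_distrib_left mult.left_commute)
  then show ?thesis
    by (simp add: diag_def bvec_def vec_eq_iff algebra_simps)
qed

text \<open>The image of \<open>D\<close> has trace zero, and \<open>D\<close> kills the part that \<open>\<theta>\<close> fixes.\<close>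
lemma theta_diag:
  assumes "(2::'a::field) \<noteq> 0"
  shows "theta (diag l b a) = - diag l b (a :: 'a^4)" "diag l b (theta a) = - diag l b a"
  by (cases rule: bvec_cases[OF assms, of a];
      simp add: theta_bvec[OF assms] diag_bvec[OF assms] bvec_minus)+

text \<open>
  On basis vectors \<open>V\<^sub>i\<close>, \<open>V\<^sub>j\<close> with product \<open>V\<^sub>k\<close> the identity says that the eigenvalues satisfy
  \<open>q\<^sub>k = -q\<^sub>i - q\<^sub>j\<close>.
\<close>
lemma diag_mult:
  assumes "(2::'a::field) \<noteq> 0"
  shows "diag l b (x * y) = theta x * diag l b y - theta (theta y * diag l b (x :: 'a^4))"
proof -
  obtain p0 p1 p2 p3 r0 r1 r2 r3 where x: "x = bvec p0 p1 p2 p3" and y: "y = bvec r0 r1 r2 r3"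
    by (metis bvec_cases[OF assms])
  show ?thesis
    unfolding x y diff_conv_add_uminus bvec_mult theta_bvec[OF assms] diag_bvec[OF assms]
      bvec_minus bvec_add
    by (rule arg_cong4[where f = bvec]) (simp_all add: algebra_simps)
qed

lemma qd_eq_swap_diag:
  assumes two: "(2::'a::field) \<noteq> 0"
  shows "qd l b = (\<lambda>(u, w). (diag l b w, diag l b (u :: 'a^4)))"
proof (rule eq_qdI[OF two, symmetric])
  fix r0 r1 r2 r3 :: "'a qcayley"
  assume r: "r0 \<in> qK" "r1 \<in> qK" "r2 \<in> qK" "r3 \<in> qK"
  then obtain a0 c0 a1 c1 a2 c2 a3 c3 where
    r: "r0 = a0 *\<^sub>q qone + c0 *\<^sub>q qs" "r1 = a1 *\<^sub>q qone + c1 *\<^sub>q qs"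
       "r2 = a2 *\<^sub>q qone + c2 *\<^sub>q qs" "r3 = a3 *\<^sub>q qone + c3 *\<^sub>q qs"
    by (auto simp: qK_def)
  have pres: "r0 \<odot> qone + r1 \<odot> x1 + r2 \<odot> x2 + r3 \<odot> x3 = (bvec a0 a1 a2 a3, bvec c0 c1 c2 c3)"
    unfolding r qpres_def[symmetric] qpres_eq[OF two] bvec_def ..
  show "(case r0 \<odot> qone + r1 \<odot> x1 + r2 \<odot> x2 + r3 \<odot> x3 of (u, w) \<Rightarrow> (diag l b w, diag l b u)) =
      l *\<^sub>q (r1 \<odot> (qs \<odot> x1)) + b *\<^sub>q (r2 \<odot> (qs \<odot> x2)) - (l + b) *\<^sub>q (r3 \<odot> (qs \<odot> x3))"
    unfolding pres unfolding r x1_def x2_def x3_def qs_mult[OF two] qK_mult[OF two]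
    by (simp add: diag_bvec[OF two]) (simp add: bvec_def vec_eq_iff algebra_simps)
qed

lemma qd_in_qDer:
  assumes two: "(2::'a::field) \<noteq> 0"
  shows "(qd l b :: 'a qcayley \<Rightarrow> _) \<in> qDer"
proof -
  let ?d = "qd l b :: 'a qcayley \<Rightarrow> _" and ?D = "diag l b :: 'a^4 \<Rightarrow> _"
  note d = qd_eq_swap_diag[OF two, of l b]
  have minus: "?D (- a) = - ?D a" for a
    using diag_scale[of l b "- 1" a] by (simp add: vec_eq_iff)
  have "Vector_Spaces.linear (*\<^sub>q) (*\<^sub>q) ?d"
    unfolding linear_iff_module_hom
    by (intro module_hom.intro module_hom_axioms.intro
        vector_space_qscale[folded module_iff_vector_space])
      (auto simp: d diag_add diag_scale)
  moreover have "?d (x \<odot> y) = ?d x \<odot> y + x \<odot> ?d y" for x y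
  proof -
    obtain a1 a2 a3 a4 where x: "x = (a1, a2)" and y: "y = (a3, a4)"
      by (cases x; cases y)
    \<comment> \<open>The coordinates mix \<open>a\<^sub>1, a\<^sub>2\<close> with \<open>a\<^sub>3, a\<^sub>4\<close>, and each of the four mixed parts is the
      twisted Leibniz rule with the factors ordered and twisted suitably.\<close>
    have "?D (theta a1 * a4) = a1 * ?D a4 + theta (?D a1 * theta a4)"
      using diag_mult[OF two, of l b "theta a1" a4] two
      by (simp add: theta_diag theta_minus mult.commute)
    moreover have "?D (theta (theta a2 * theta a3)) = ?D a2 * a3 + theta (a2 * theta (?D a3))"
      using diag_mult[OF two, of l b "theta a3" "theta a2"] two
      by (simp add: theta_diag theta_minus mult.commute)
    moreover have "?D (a1 * a3) = theta a1 * ?D a3 + theta (theta (?D a1) * theta a3)"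
      using diag_mult[OF two, of l b a1 a3] two
      by (simp add: theta_diag theta_minus mult.commute)
    moreover have "?D (theta (a2 * theta a4)) = theta (?D a2) * a4 + theta (theta a2 * theta (?D a4))"
      using diag_mult[OF two, of l b "theta a4" a2] two
      by (simp add: theta_diag theta_minus mult.commute)
    ultimately show ?thesis
      by (simp add: x y d diag_add theta_add)
  qed
  moreover have "?d (qconj x) = qconj (?d x)" for x
    by (cases x) (simp add: d minus theta_diag[OF two])
  ultimately show ?thesis
    unfolding qDer_def by blast
qed

theorem theorem3p7:
  assumes "CHAR('a::alg_closed_field) \<notin> {2, 3, 5}"
  shows "(qDer :: ('a qcayley \<Rightarrow> 'a qcayley) set) = {qd l b | l b. True}"
proof -
  have "\<not> CHAR('a) dvd 2"
    using assms CHAR_not_1[where 'a = 'a] two_is_prime_nat by (auto simp: prime_nat_iff)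
  then have two: "(2::'a) \<noteq> 0"
    using of_nat_eq_0_iff_char_dvd[where 'a = 'a, of 2] by simp
  show ?thesis
    using qDer_is_qd[OF two] qd_in_qDer[OF two] by auto
qed

end
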